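(* Let $f:(0,\infty)\to\mathbb R$. The following are equivalent: 1. For every $n\ge1$ and every $A\in\mathcal C_{\min,n}^{\circ}$, one has $f[A]\in\mathcal C_{\min,n}^{\circ}$. 2. For every $n\ge1$ and every $A\in\mathcal C_{\min,n}^{\circ}$, the matrix $f[A]$ is a nonsingular inverse $M$-matrix. 3. $f(t)>0$ for all $t>0$, and $f$ is strictly increasing on $(0,\infty)$. The same equivalence holds with $\mathcal C_{\min,n}^{\circ}$ replaced by $\mathcal C_{\max,n}^{\circ}$ throughout.
   Context: For $x=(x_1,\ldots,x_n)\in\mathbb R^n$, define the $n\times n$ real symmetric matrices $A_{\min}(x)=\bigl(x_{\min(i,j)}\bigr)_{i,j=1}^n$ and $A_{\max}(x)=\bigl(x_{\max(i,j)}\bigr)_{i,j=1}^n$. The strict Min and Max cones are $\mathcal C_{\min,n}^{\circ}=\{A_{\min}(x):0<x_1<x_2<\cdots<x_n\}$ and $\mathcal C_{\max,n}^{\circ}=\{A_{\max}(x):x_1>x_2>\cdots>x_n>0\}$. For a matrix $A=(a_{ij})$ with positive entries, $f[A]=(f(a_{ij}))$. A $Z$-matrix is a real square matrix whose off-diagonal entries are nonpositive. A nonsingular $M$-matrix is a nonsingular $Z$-matrix whose inverse is entrywise nonnegative. A matrix $A$ is a nonsingular inverse $M$-matrix if $A$ is nonsingular and $A^{-1}$ is a nonsingular $M$-matrix. *)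

theory Defs
  imports Complex_Main "Jordan_Normal_Form.Matrix"
begin

text \<open>Indices start at 0: the entries \<open>x\<^sub>1, \<dots>, x\<^sub>n\<close> of a vector are
  \<open>x $ 0, \<dots>, x $ (n - 1)\<close>, which leaves the matrices unchanged.\<close>

definition A_min :: "real vec \<Rightarrow> real mat" where
  "A_min x = mat (dim_vec x) (dim_vec x) (\<lambda>(i, j). x $ min i j)"

definition A_max :: "real vec \<Rightarrow> real mat" where
  "A_max x = mat (dim_vec x) (dim_vec x) (\<lambda>(i, j). x $ max i j)"

definition min_cone :: "nat \<Rightarrow> real mat set" where
  "min_cone n = {A_min x | x. x \<in> carrier_vec n \<and> (\<forall>i<n. 0 < x $ i) \<and>
                              (\<forall>i j. i < j \<longrightarrow> j < n \<longrightarrow> x $ i < x $ j)}"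

definition max_cone :: "nat \<Rightarrow> real mat set" where
  "max_cone n = {A_max x | x. x \<in> carrier_vec n \<and> (\<forall>i<n. 0 < x $ i) \<and>
                              (\<forall>i j. i < j \<longrightarrow> j < n \<longrightarrow> x $ i > x $ j)}"

definition Z_matrix :: "real mat \<Rightarrow> bool" where
  "Z_matrix A \<longleftrightarrow> square_mat A \<and>
     (\<forall>i<dim_row A. \<forall>j<dim_col A. i \<noteq> j \<longrightarrow> A $$ (i, j) \<le> 0)"

definition nonneg_entries :: "real mat \<Rightarrow> bool" where
  "nonneg_entries A \<longleftrightarrow> (\<forall>i<dim_row A. \<forall>j<dim_col A. 0 \<le> A $$ (i, j))"

text \<open>Below, \<open>B\<close> is the inverse of the square matrix \<open>A\<close>: the two
  \<^const>\<open>inverts_mat\<close> conditions force \<open>B\<close> to have the same dimensions as \<open>A\<close>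
  and determine it uniquely.\<close>

definition nonsingular_M_matrix :: "real mat \<Rightarrow> bool" where
  "nonsingular_M_matrix A \<longleftrightarrow> Z_matrix A \<and> invertible_mat A \<and>
     (\<exists>B. inverts_mat A B \<and> inverts_mat B A \<and> nonneg_entries B)"

definition nonsingular_inverse_M_matrix :: "real mat \<Rightarrow> bool" where
  "nonsingular_inverse_M_matrix A \<longleftrightarrow> invertible_mat A \<and>
     (\<exists>B. inverts_mat A B \<and> inverts_mat B A \<and> nonsingular_M_matrix B)"

end

theory Submission
  imports Defs
begin

text \<open>
  The matrix \<^term>\<open>A_min x\<close> depends on the increments \<open>d\<^sub>k = x\<^sub>k - x\<^sub>k\<^sub>-\<^sub>1\<close> (with
  \<open>x\<^sub>-\<^sub>1 = 0\<close>) through the factorization \<open>L D L\<^sup>T\<close>, where \<open>L\<close> is the lower triangular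
  matrix of ones and \<open>D\<close> the diagonal matrix of the \<open>d\<^sub>k\<close>. Inverting the factors gives a
  tridiagonal matrix whose entries next to the diagonal are \<open>-1 / d\<^sub>k\<close>. On the strict Min cone all
  increments are positive, so this inverse is a Z-matrix, and every matrix of the cone is an
  inverse M-matrix (\<open>min_cone_inverse_M\<close>).

  Since \<open>f\<close> acts on \<^term>\<open>A_min x\<close> by acting on the vector \<open>x\<close>, positivity and strict
  monotonicity of \<open>f\<close> make \<open>f\<close> preserve the cone, and hence produce inverse M-matrices. For
  the way back the sizes one and two suffice: the nonsingular nonnegative matrix \<open>(f t)\<close> yields
  \<open>f t > 0\<close>, and the sign of the off-diagonal entry in the inverse of the matrix with rows
  \<open>(f s, f s)\<close> and \<open>(f s, f t)\<close> yields \<open>f s < f t\<close> (\<open>pos_strict_mono_if_inverse_M\<close>).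

  The Max cone is the image of the Min cone under reversing the order of both rows and columns.
  This reversal is a multiplicative involution on square matrices that commutes with entrywise
  maps and preserves the sign conditions, so the two conditions on matrices mean the same for
  both cones.
\<close>

section \<open>Inverse M-matrices of a given size\<close>

text \<open>Both M-matrix conditions speak of some inverse. Inverses are unique, so the inverse of the
  inverse that has to be nonnegative is the matrix itself.\<close>

lemma nonsingular_inverse_M_matrix_iff:
  assumes A: "A \<in> carrier_mat n n"
  shows "nonsingular_inverse_M_matrix A \<longleftrightarrow>
    (\<forall>i<n. \<forall>j<n. 0 \<le> A $$ (i, j)) \<and>
    (\<exists>B\<in>carrier_mat n n. A * B = 1\<^sub>m n \<and> B * A = 1\<^sub>m n \<and>
       (\<forall>i<n. \<forall>j<n. i \<noteq> j \<longrightarrow> B $$ (i, j) \<le> 0))"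
    (is "?L \<longleftrightarrow> ?R")
proof
  assume ?L
  then obtain B where AB: "inverts_mat A B" and BA: "inverts_mat B A"
    and M: "nonsingular_M_matrix B"
    unfolding nonsingular_inverse_M_matrix_def by blast
  from AB A have AB1: "A * B = 1\<^sub>m n" by (auto simp: inverts_mat_def)
  then have "dim_col B = n" by (metis index_mult_mat(3) index_one_mat(3))
  moreover from M have "dim_row B = dim_col B"
    by (auto simp: nonsingular_M_matrix_def Z_matrix_def)
  ultimately have B: "B \<in> carrier_mat n n" by auto
  from BA B have BA1: "B * A = 1\<^sub>m n" by (auto simp: inverts_mat_def)
  from M obtain C where BC: "inverts_mat B C" and CB: "inverts_mat C B"
    and C0: "nonneg_entries C"
    unfolding nonsingular_M_matrix_def by blast
  from BC B have BC1: "B * C = 1\<^sub>m n" by (auto simp: inverts_mat_def)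
  then have "dim_col C = n" by (metis index_mult_mat(3) index_one_mat(3))
  moreover have "dim_row C = n"
    using CB B unfolding inverts_mat_def
    by (metis carrier_matD(2) index_mult_mat(3) index_one_mat(3))
  ultimately have C: "C \<in> carrier_mat n n" by auto
  have "C = A * B * C" using AB1 C by simp
  also have "\<dots> = A * (B * C)" using A B C by simp
  also have "\<dots> = A" using BC1 A by simp
  finally have "C = A" .
  with C0 A have "\<forall>i<n. \<forall>j<n. 0 \<le> A $$ (i, j)" by (auto simp: nonneg_entries_def)
  moreover have "\<forall>i<n. \<forall>j<n. i \<noteq> j \<longrightarrow> B $$ (i, j) \<le> 0"
    using M B by (auto simp: nonsingular_M_matrix_def Z_matrix_def)
  ultimately show ?R using B AB1 BA1 by blast
next
  assume ?R
  then obtain B where B: "B \<in> carrier_mat n n" and AB: "A * B = 1\<^sub>m n" and BA: "B * A = 1\<^sub>m n"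
    and Z: "\<forall>i<n. \<forall>j<n. i \<noteq> j \<longrightarrow> B $$ (i, j) \<le> 0"
    and A0: "\<forall>i<n. \<forall>j<n. 0 \<le> A $$ (i, j)" by blast
  have inv: "inverts_mat A B" "inverts_mat B A" using A B AB BA by (auto simp: inverts_mat_def)
  have "invertible_mat A" "invertible_mat B"
    using inv A B unfolding invertible_mat_def by auto
  moreover have "Z_matrix B" "nonneg_entries A"
    using A B Z A0 by (auto simp: Z_matrix_def nonneg_entries_def)
  ultimately show ?L
    using inv unfolding nonsingular_inverse_M_matrix_def nonsingular_M_matrix_def by blast
qed

section \<open>The tridiagonal inverse of a Min matrix\<close>

text \<open>This is \<open>L\<^sup>-\<^sup>T C L\<^sup>-\<^sup>1\<close> for the lower triangular matrix \<open>L\<close> of ones and the diagonal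
  matrix \<open>C\<close> with entries \<open>c 0, \<dots>, c (n - 1)\<close>, provided that \<open>c n = 0\<close>.\<close>

definition tridiagonal :: "nat \<Rightarrow> (nat \<Rightarrow> real) \<Rightarrow> real mat" where
  "tridiagonal n c = mat n n (\<lambda>(i, j).
     if i = j then c i + c (Suc i)
     else if i = Suc j then - c i
     else if j = Suc i then - c j
     else 0)"

lemma tridiagonal_carrier: "tridiagonal n c \<in> carrier_mat n n"
  by (simp add: tridiagonal_def)

text \<open>A row of the tridiagonal matrix acts as a weighted second difference; the weight
  \<open>c n = 0\<close> removes the value \<open>v n\<close> beyond the last index from the last row.\<close>

lemma tridiagonal_row_sum:
  assumes i: "i < n" and c: "c n = 0"
  shows "(\<Sum>k<n. tridiagonal n c $$ (i, k) * v k) =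
    c i * (v i - (if i = 0 then 0 else v (i - 1))) - c (Suc i) * (v (Suc i) - v i)"
proof -
  have "(\<Sum>k<n. tridiagonal n c $$ (i, k) * v k) =
    (\<Sum>k<n. (if k = i then (c i + c (Suc i)) * v i else 0)
         - (if k = i - 1 then (if i = 0 then 0 else c i * v (i - 1)) else 0)
         - (if k = Suc i then c (Suc i) * v (Suc i) else 0))"
    using i by (intro sum.cong) (auto simp: tridiagonal_def)
  also have "\<dots> = (c i + c (Suc i)) * v i - (if i = 0 then 0 else c i * v (i - 1))
      - (if Suc i < n then c (Suc i) * v (Suc i) else 0)"
    using i by (simp add: sum_subtractf)
  also have "(if Suc i < n then c (Suc i) * v (Suc i) else 0) = c (Suc i) * v (Suc i)"
    using i c by (cases "Suc i = n") auto
  finally show ?thesis by (auto simp: algebra_simps)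
qed

definition increment :: "real vec \<Rightarrow> nat \<Rightarrow> real" where
  "increment x k = (if k = 0 then x $ 0 else x $ k - x $ (k - 1))"

text \<open>Column \<open>j\<close> of the Min matrix follows \<open>x\<close> up to index \<open>j\<close> and is constant afterwards. Its
  differences, rescaled by the inverse increments, are therefore the indicator of \<open>k \<le> j\<close>, and
  the differences of that indicator form a unit vector.\<close>

lemma tridiagonal_mult_A_min:
  assumes x: "x \<in> carrier_vec n" and d: "\<And>k. k < n \<Longrightarrow> increment x k \<noteq> 0"
  shows "tridiagonal n (\<lambda>k. if k < n then inverse (increment x k) else 0) * A_min x = 1\<^sub>m n"
    (is "tridiagonal n ?c * _ = _")
proof (rule eq_matI)
  fix i j assume "i < dim_row (1\<^sub>m n :: real mat)" "j < dim_col (1\<^sub>m n :: real mat)"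
  then have i: "i < n" and j: "j < n" by auto
  have scaled_diff: "?c k * (x $ min k j - (if k = 0 then 0 else x $ min (k - 1) j))
      = (if k \<le> j then 1 else 0)" for k
  proof (cases "k \<le> j")
    case True
    then show ?thesis using d[of k] j by (auto simp: increment_def)
  next
    case False
    then have "min k j = j" "k \<noteq> 0" "min (k - 1) j = j" by auto
    with False show ?thesis by simp
  qed
  have "(tridiagonal n ?c * A_min x) $$ (i, j)
      = (\<Sum>k<n. tridiagonal n ?c $$ (i, k) * x $ min k j)"
    using i j x
    by (auto simp: times_mat_def scalar_prod_def A_min_def tridiagonal_def lessThan_atLeast0
        intro!: sum.cong)
  also have "\<dots> = ?c i * (x $ min i j - (if i = 0 then 0 else x $ min (i - 1) j))
      - ?c (Suc i) * (x $ min (Suc i) j - x $ min i j)"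
    using tridiagonal_row_sum[OF i, of ?c "\<lambda>k. x $ min k j"] by simp
  also have "\<dots> = (if i \<le> j then 1 else 0) - (if Suc i \<le> j then 1 else 0)"
    using scaled_diff[of i] scaled_diff[of "Suc i"] by simp
  also have "\<dots> = 1\<^sub>m n $$ (i, j)" using i j by auto
  finally show "(tridiagonal n ?c * A_min x) $$ (i, j) = 1\<^sub>m n $$ (i, j)" .
qed (use x in \<open>auto simp: tridiagonal_def A_min_def\<close>)

lemma min_cone_carrier: "A \<in> min_cone n \<Longrightarrow> A \<in> carrier_mat n n"
  by (auto simp: min_cone_def A_min_def)

lemma min_cone_inverse_M:
  assumes "A \<in> min_cone n"
  shows "nonsingular_inverse_M_matrix A"
proof -
  obtain x where A: "A = A_min x" and x: "x \<in> carrier_vec n"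
    and pos: "\<And>i. i < n \<Longrightarrow> 0 < x $ i" and inc: "\<And>i j. i < j \<Longrightarrow> j < n \<Longrightarrow> x $ i < x $ j"
    using assms by (auto simp: min_cone_def)
  have d: "increment x k > 0" if "k < n" for k
    using that pos[of 0] inc[of "k - 1" k] by (auto simp: increment_def)
  define c where "c = (\<lambda>k. if k < n then inverse (increment x k) else 0)"
  define B where "B = tridiagonal n c"
  have B: "B \<in> carrier_mat n n" by (simp add: B_def tridiagonal_carrier)
  have cA: "A \<in> carrier_mat n n" by (rule min_cone_carrier[OF assms])
  have BA: "B * A = 1\<^sub>m n"
    unfolding A B_def c_def using d by (intro tridiagonal_mult_A_min x) (metis less_irrefl)
  \<comment> \<open>Both matrices are symmetric, so transposing turns the left inverse into a right inverse.\<close>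
  have "A\<^sup>T = A" using x by (auto simp: A A_min_def min.commute intro!: eq_matI)
  moreover have "B\<^sup>T = B" by (auto simp: B_def tridiagonal_def intro!: eq_matI)
  ultimately have "A * B = (B * A)\<^sup>T" using transpose_mult[OF B cA] by simp
  then have AB: "A * B = 1\<^sub>m n" by (simp add: BA)
  have "c k \<ge> 0" for k using d[of k] by (auto simp: c_def less_imp_le)
  then have "\<forall>i<n. \<forall>j<n. i \<noteq> j \<longrightarrow> B $$ (i, j) \<le> 0" by (auto simp: B_def tridiagonal_def)
  moreover have "\<forall>i<n. \<forall>j<n. 0 \<le> A $$ (i, j)"
    using pos x by (auto simp: A A_min_def min_def less_imp_le)
  ultimately show ?thesis
    using nonsingular_inverse_M_matrix_iff[OF cA] AB BA B by blast
qed

section \<open>The equivalence for the Min cone\<close>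

lemma map_mat_min_cone:
  assumes "\<forall>t>0. f t > 0" and "strict_mono_on {0<..} f" and "A \<in> min_cone n"
  shows "map_mat f A \<in> min_cone n"
proof -
  obtain x where A: "A = A_min x" and x: "x \<in> carrier_vec n"
    and pos: "\<And>i. i < n \<Longrightarrow> 0 < x $ i" and inc: "\<And>i j. i < j \<Longrightarrow> j < n \<Longrightarrow> x $ i < x $ j"
    using assms(3) by (auto simp: min_cone_def)
  have "map_mat f A = A_min (map_vec f x)"
    using x by (auto simp: A A_min_def intro!: eq_matI)
  moreover have "f (x $ i) < f (x $ j)" if "i < j" "j < n" for i j
    using that assms(2) pos inc by (auto simp: strict_mono_on_def)
  ultimately show ?thesis
    unfolding min_cone_def using x pos assms(1)
    by (auto intro!: exI[of _ "map_vec f x"])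
qed

text \<open>The members \<open>(t)\<close> and \<open>A_min (s, t)\<close> of the cone suffice: nonsingularity and nonnegativity
  of \<open>(f t)\<close> force \<open>f t > 0\<close>, and the inverse of the two by two matrix has the off-diagonal entry
  \<open>-1 / (f t - f s)\<close>, which is nonpositive only if \<open>f s < f t\<close>.\<close>

lemma pos_strict_mono_if_inverse_M:
  assumes M: "\<And>n A. n \<ge> 1 \<Longrightarrow> A \<in> min_cone n \<Longrightarrow> nonsingular_inverse_M_matrix (map_mat f A)"
  shows "(\<forall>t>0. f t > 0) \<and> strict_mono_on {0<..} f"
proof
  show pos: "\<forall>t>0. f t > 0"
  proof (intro allI impI)
    fix t :: real assume t: "t > 0"
    let ?A = "A_min (vec 1 (\<lambda>_. t))"
    have cone: "?A \<in> min_cone 1"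
      unfolding min_cone_def using t by auto
    have car: "map_mat f ?A \<in> carrier_mat 1 1" by (simp add: A_min_def)
    from M[OF _ cone] obtain B where B: "B \<in> carrier_mat 1 1"
      and nonneg: "\<forall>i<1. \<forall>j<1. 0 \<le> map_mat f ?A $$ (i, j)"
      and AB: "map_mat f ?A * B = 1\<^sub>m 1"
      unfolding nonsingular_inverse_M_matrix_iff[OF car] by auto
    have "f t \<ge> 0" using nonneg by (simp add: A_min_def)
    moreover have "f t * B $$ (0, 0) = 1"
      using arg_cong[OF AB, of "\<lambda>C. C $$ (0, 0)"] B
      by (simp add: A_min_def times_mat_def scalar_prod_def)
    ultimately show "f t > 0" by (cases "f t = 0") auto
  qed
  show "strict_mono_on {0<..} f"
  proof (rule strict_mono_onI)
    fix s t :: real assume "s \<in> {0<..}" "t \<in> {0<..}" and st: "s < t"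
    then have s: "s > 0" and t: "t > 0" by auto
    let ?x = "vec 2 (\<lambda>i. if i = 0 then s else t)"
    let ?A = "A_min ?x"
    have cone: "?A \<in> min_cone 2"
      unfolding min_cone_def using s t st by (auto intro!: exI[of _ ?x])
    have car: "map_mat f ?A \<in> carrier_mat 2 2" by (simp add: A_min_def)
    from M[OF _ cone] obtain B where B: "B \<in> carrier_mat 2 2"
      and AB: "map_mat f ?A * B = 1\<^sub>m 2"
      and Z: "\<forall>i<2. \<forall>j<2. i \<noteq> j \<longrightarrow> B $$ (i, j) \<le> 0"
      unfolding nonsingular_inverse_M_matrix_iff[OF car] by auto
    \<comment> \<open>Only the second column of the inverse matters: its entries are opposite to each other,
      and its second entry is the inverse of \<open>f t - f s\<close>.\<close>
    have "f s * B $$ (0, 1) + f s * B $$ (1, 1) = 0"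
      using arg_cong[OF AB, of "\<lambda>C. C $$ (0, 1)"] B
      by (simp add: A_min_def times_mat_def scalar_prod_def numeral_2_eq_2)
    then have "f s * (B $$ (0, 1) + B $$ (1, 1)) = 0" by (simp add: distrib_left)
    moreover have "f s > 0" using pos s by simp
    ultimately have opp: "B $$ (0, 1) = - B $$ (1, 1)" by simp
    have "f s * B $$ (0, 1) + f t * B $$ (1, 1) = 1"
      using arg_cong[OF AB, of "\<lambda>C. C $$ (1, 1)"] B
      by (simp add: A_min_def times_mat_def scalar_prod_def numeral_2_eq_2)
    then have "(f t - f s) * B $$ (1, 1) = 1" using opp by (simp add: algebra_simps)
    moreover have "B $$ (1, 1) \<ge> 0" using Z[rule_format, of 0 1] opp by simp
    ultimately have "f t - f s > 0"
      by (metis mult_nonpos_nonneg not_one_le_zero not_less)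
    then show "f s < f t" by simp
  qed
qed

section \<open>Reversal of rows and columns\<close>

definition reverse_mat :: "'a mat \<Rightarrow> 'a mat" where
  "reverse_mat A = mat (dim_row A) (dim_col A)
     (\<lambda>(i, j). A $$ (dim_row A - Suc i, dim_col A - Suc j))"

lemma reverse_mat_carrier: "A \<in> carrier_mat n m \<Longrightarrow> reverse_mat A \<in> carrier_mat n m"
  by (simp add: reverse_mat_def)

lemma reverse_mat_reverse_mat: "reverse_mat (reverse_mat A) = A"
  by (auto simp: reverse_mat_def intro!: eq_matI)

lemma reverse_mat_map_mat: "reverse_mat (map_mat f A) = map_mat f (reverse_mat A)"
  by (auto simp: reverse_mat_def intro!: eq_matI)

lemma reverse_mat_one: "reverse_mat (1\<^sub>m n) = 1\<^sub>m n"
  by (auto simp: reverse_mat_def intro!: eq_matI)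

lemma reverse_mat_mult:
  fixes A B :: "'a :: semiring_0 mat"
  assumes A: "A \<in> carrier_mat n m" and B: "B \<in> carrier_mat m p"
  shows "reverse_mat (A * B) = reverse_mat A * reverse_mat B"
proof (rule eq_matI)
  fix i j assume "i < dim_row (reverse_mat A * reverse_mat B)"
    "j < dim_col (reverse_mat A * reverse_mat B)"
  then have i: "i < n" and j: "j < p" using A B by (auto simp: reverse_mat_def)
  have "(\<Sum>k<m. A $$ (n - Suc i, k) * B $$ (k, p - Suc j))
      = (\<Sum>k<m. A $$ (n - Suc i, m - Suc k) * B $$ (m - Suc k, p - Suc j))"
    by (rule sum.nat_diff_reindex[symmetric])
  then show "reverse_mat (A * B) $$ (i, j) = (reverse_mat A * reverse_mat B) $$ (i, j)"
    using i j A B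
    by (auto simp: reverse_mat_def times_mat_def scalar_prod_def lessThan_atLeast0)
qed (use A B in \<open>auto simp: reverse_mat_def\<close>)

lemma inverse_M_reverse_mat:
  assumes A: "A \<in> carrier_mat n n" and M: "nonsingular_inverse_M_matrix A"
  shows "nonsingular_inverse_M_matrix (reverse_mat A)"
proof -
  from M obtain B where B: "B \<in> carrier_mat n n" and AB: "A * B = 1\<^sub>m n" and BA: "B * A = 1\<^sub>m n"
    and Z: "\<forall>i<n. \<forall>j<n. i \<noteq> j \<longrightarrow> B $$ (i, j) \<le> 0"
    and A0: "\<forall>i<n. \<forall>j<n. 0 \<le> A $$ (i, j)"
    unfolding nonsingular_inverse_M_matrix_iff[OF A] by blast
  have "reverse_mat A * reverse_mat B = 1\<^sub>m n" "reverse_mat B * reverse_mat A = 1\<^sub>m n"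
    using reverse_mat_mult[OF A B, symmetric] reverse_mat_mult[OF B A, symmetric]
    unfolding AB BA reverse_mat_one .
  moreover have "\<forall>i<n. \<forall>j<n. i \<noteq> j \<longrightarrow> reverse_mat B $$ (i, j) \<le> 0"
    using Z B by (auto simp: reverse_mat_def)
  moreover have "\<forall>i<n. \<forall>j<n. 0 \<le> reverse_mat A $$ (i, j)"
    using A0 A by (auto simp: reverse_mat_def)
  ultimately show ?thesis
    unfolding nonsingular_inverse_M_matrix_iff[OF reverse_mat_carrier[OF A]]
    using reverse_mat_carrier[OF B] by blast
qed

lemma inverse_M_reverse_mat_iff:
  assumes "A \<in> carrier_mat n n"
  shows "nonsingular_inverse_M_matrix (reverse_mat A) \<longleftrightarrow> nonsingular_inverse_M_matrix A"
  using inverse_M_reverse_mat[OF assms] inverse_M_reverse_mat[OF reverse_mat_carrier[OF assms]]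
  by (auto simp: reverse_mat_reverse_mat)

text \<open>The index map \<open>i \<mapsto> n - 1 - i\<close> exchanges minima with maxima and increasing vectors with
  decreasing ones.\<close>

lemma reverse_mat_min_cone:
  assumes "A \<in> min_cone n" shows "reverse_mat A \<in> max_cone n"
proof -
  obtain x where A: "A = A_min x" and x: "x \<in> carrier_vec n"
    and pos: "\<And>i. i < n \<Longrightarrow> 0 < x $ i" and inc: "\<And>i j. i < j \<Longrightarrow> j < n \<Longrightarrow> x $ i < x $ j"
    using assms by (auto simp: min_cone_def)
  let ?y = "vec n (\<lambda>i. x $ (n - Suc i))"
  have "min (n - Suc i) (n - Suc j) = n - Suc (max i j)" for i j by arith
  then have "reverse_mat A = A_max ?y"
    using x by (auto simp: A A_min_def A_max_def reverse_mat_def intro!: eq_matI)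
  then show ?thesis
    unfolding max_cone_def using pos inc by (auto intro!: exI[of _ ?y])
qed

lemma reverse_mat_max_cone:
  assumes "A \<in> max_cone n" shows "reverse_mat A \<in> min_cone n"
proof -
  obtain x where A: "A = A_max x" and x: "x \<in> carrier_vec n"
    and pos: "\<And>i. i < n \<Longrightarrow> 0 < x $ i" and dec: "\<And>i j. i < j \<Longrightarrow> j < n \<Longrightarrow> x $ i > x $ j"
    using assms by (auto simp: max_cone_def)
  let ?y = "vec n (\<lambda>i. x $ (n - Suc i))"
  have "max (n - Suc i) (n - Suc j) = n - Suc (min i j)" for i j by arith
  then have "reverse_mat A = A_min ?y"
    using x by (auto simp: A A_min_def A_max_def reverse_mat_def intro!: eq_matI)
  then show ?thesis
    unfolding min_cone_def using pos dec by (auto intro!: exI[of _ ?y])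
qed

lemma reverse_mat_in_min_cone_iff: "reverse_mat A \<in> min_cone n \<longleftrightarrow> A \<in> max_cone n"
  using reverse_mat_min_cone[of "reverse_mat A" n] reverse_mat_max_cone
  by (auto simp: reverse_mat_reverse_mat)

lemma max_cone_eq_reverse_mat_image: "max_cone n = reverse_mat ` min_cone n"
  using reverse_mat_min_cone reverse_mat_max_cone reverse_mat_reverse_mat
  by (metis equalityI image_eqI image_subsetI subsetI)

lemma preserves_max_cone_iff:
  "(\<forall>A\<in>max_cone n. map_mat f A \<in> max_cone n) \<longleftrightarrow>
   (\<forall>A\<in>min_cone n. map_mat f A \<in> min_cone n)"
proof -
  have "map_mat f (reverse_mat A) \<in> max_cone n \<longleftrightarrow> map_mat f A \<in> min_cone n" for A
    using reverse_mat_in_min_cone_iff[of "map_mat f (reverse_mat A)" n]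
    by (simp add: reverse_mat_map_mat reverse_mat_reverse_mat)
  then have "(\<forall>A\<in>reverse_mat ` min_cone n. map_mat f A \<in> max_cone n) \<longleftrightarrow>
      (\<forall>A\<in>min_cone n. map_mat f A \<in> min_cone n)" by simp
  then show ?thesis by (simp only: max_cone_eq_reverse_mat_image[symmetric])
qed

lemma inverse_M_on_max_cone_iff:
  "(\<forall>A\<in>max_cone n. nonsingular_inverse_M_matrix (map_mat f A)) \<longleftrightarrow>
   (\<forall>A\<in>min_cone n. nonsingular_inverse_M_matrix (map_mat f A))"
proof -
  have "nonsingular_inverse_M_matrix (map_mat f (reverse_mat A)) \<longleftrightarrow>
      nonsingular_inverse_M_matrix (map_mat f A)" if "A \<in> min_cone n" for A
    using inverse_M_reverse_mat_iff[of "map_mat f A" n] min_cone_carrier[OF that]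
    by (simp add: reverse_mat_map_mat)
  then show ?thesis by (simp add: max_cone_eq_reverse_mat_image)
qed

section \<open>The equivalence for both cones\<close>

theorem proposition4p6:
  fixes f :: "real \<Rightarrow> real"
  shows
    "((\<forall>n\<ge>1. \<forall>A\<in>min_cone n. map_mat f A \<in> min_cone n) \<longleftrightarrow>
      (\<forall>n\<ge>1. \<forall>A\<in>min_cone n. nonsingular_inverse_M_matrix (map_mat f A))) \<and>
     ((\<forall>n\<ge>1. \<forall>A\<in>min_cone n. nonsingular_inverse_M_matrix (map_mat f A)) \<longleftrightarrow>
      ((\<forall>t>0. f t > 0) \<and> strict_mono_on {0<..} f)) \<and>
     ((\<forall>n\<ge>1. \<forall>A\<in>max_cone n. map_mat f A \<in> max_cone n) \<longleftrightarrow>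
      (\<forall>n\<ge>1. \<forall>A\<in>max_cone n. nonsingular_inverse_M_matrix (map_mat f A))) \<and>
     ((\<forall>n\<ge>1. \<forall>A\<in>max_cone n. nonsingular_inverse_M_matrix (map_mat f A)) \<longleftrightarrow>
      ((\<forall>t>0. f t > 0) \<and> strict_mono_on {0<..} f))"
proof -
  let ?P = "\<forall>n\<ge>1. \<forall>A\<in>min_cone n. map_mat f A \<in> min_cone n"
  let ?M = "\<forall>n\<ge>1. \<forall>A\<in>min_cone n. nonsingular_inverse_M_matrix (map_mat f A)"
  let ?F = "(\<forall>t>0. f t > 0) \<and> strict_mono_on {0<..} f"
  have "?P \<Longrightarrow> ?M" using min_cone_inverse_M by blast
  moreover have "?M \<Longrightarrow> ?F" using pos_strict_mono_if_inverse_M by blast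
  moreover have "?F \<Longrightarrow> ?P" using map_mat_min_cone by blast
  ultimately have "(?P \<longleftrightarrow> ?M) \<and> (?M \<longleftrightarrow> ?F)" by blast
  then show ?thesis unfolding preserves_max_cone_iff inverse_M_on_max_cone_iff by blast
qed

end
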